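(* Maker has a winning strategy in the $K^{\mathbb{Q}}$-building game.
   Context: Let $K^{\mathbb{Q}}$ denote the complete graph whose vertex set is the set $\mathbb{Q}$ of rational numbers; it is called the board. In the $K^{\mathbb{Q}}$-building game, two players, Maker and Breaker, take turns alternately, Maker first. In each turn the player claims one previously unclaimed edge of the board (colours it in her/his colour). The game lasts countably many (i.e. $\omega$ many) turns. Let $G_M$ be the graph formed by all edges Maker has claimed during the whole game. Maker wins if there is a set $Q \subseteq \mathbb{Q}$ such that $(Q,\le)$, with the order inherited from the usual order on $\mathbb{Q}$, is order-isomorphic to $(\mathbb{Q},\le)$ and every edge between two distinct vertices of $Q$ belongs to $G_M$ (i.e. $G_M$ contains a complete graph on $Q$). Otherwise Breaker wins. A winning strategy for Maker is a strategy guaranteeing Maker wins regardless of Breaker's moves. *)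

theory Defs
  imports Main "HOL.Rat"
begin

definition is_edge :: "rat set \<Rightarrow> bool" where
  "is_edge e \<longleftrightarrow> (\<exists>x y. x \<noteq> y \<and> e = {x, y})"

text \<open>A play is an omega-sequence of claimed edges: move 2n is Maker's (n+1)-st move,
  move 2n+1 is Breaker's. A move at time n is legal if it is an edge not claimed before.\<close>
definition legal_move :: "(nat \<Rightarrow> rat set) \<Rightarrow> nat \<Rightarrow> bool" where
  "legal_move p n \<longleftrightarrow> is_edge (p n) \<and> p n \<notin> p ` {..<n}"

definition maker_edges :: "(nat \<Rightarrow> rat set) \<Rightarrow> rat set set" where
  "maker_edges p = {p (2 * k) | k. True}"

definition maker_wins :: "(nat \<Rightarrow> rat set) \<Rightarrow> bool" where
  "maker_wins p \<longleftrightarrow> (\<exists>Q :: rat set.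
      (\<exists>f :: rat \<Rightarrow> rat. strict_mono f \<and> f ` UNIV = Q) \<and>
      (\<forall>x\<in>Q. \<forall>y\<in>Q. x \<noteq> y \<longrightarrow> {x, y} \<in> maker_edges p))"

definition follows :: "(rat set list \<Rightarrow> rat set) \<Rightarrow> (nat \<Rightarrow> rat set) \<Rightarrow> bool" where
  "follows \<sigma> p \<longleftrightarrow> (\<forall>k. p (2 * k) = \<sigma> (map p [0..<2 * k]))"

definition maker_winning_strategy :: "(rat set list \<Rightarrow> rat set) \<Rightarrow> bool" where
  "maker_winning_strategy \<sigma> \<longleftrightarrow>
     (\<forall>p. follows \<sigma> p \<and> (\<forall>k. legal_move p (2 * k + 1)) \<longrightarrow>
          (\<forall>k. legal_move p (2 * k)) \<and> maker_wins p)"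

end

theory Submission
  imports Defs "HOL-Library.Countable_Set"
begin

text \<open>
  Maker grows a tree of vertices, each joined to all its ancestors, so that every branch spans a
  complete subgraph. Colours are rational intervals, each used infinitely often; a fresh vertex
  of the next colour is routed from the root downwards. Having been joined to a node, it is
  either made a child of that node or joined to one of the children to which its edge is still
  free, preferring what was rarely chosen by vertices of the same colour. While a vertex is
  routed, Breaker can block only boundedly many children of a given node. Hence if infinitely many
  vertices of colour \<open>c\<close> reach a node, then infinitely many of them become its children, and all
  but boundedly many children are themselves reached by infinitely many vertices of colour \<open>c\<close>.

  Now choose a branch whose vertices are ordered like an enumeration of the rationals, keeping the
  colours that reach the current node infinitely often dense in some interval inside every gap of
  the finite chain chosen so far. For each gap only boundedly many children violate this, as
  otherwise some interval in the gap would avoid the colours of too many children at once; so one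
  of the infinitely many children in the required position is suitable.
\<close>

section \<open>Dense chains in fair trees\<close>

definition has_colour :: "(rat \<times> rat) set \<Rightarrow> rat \<Rightarrow> rat \<Rightarrow> bool" where
  "has_colour C a b \<longleftrightarrow> (\<exists>c d. (c, d) \<in> C \<and> a \<le> c \<and> c < d \<and> d \<le> b)"

text \<open>Density in the sense of a pi-base. A family dense in no subinterval is the analogue of a
  nowhere dense set.\<close>

definition dense_colours :: "(rat \<times> rat) set \<Rightarrow> rat \<Rightarrow> rat \<Rightarrow> bool" where
  "dense_colours C u v \<longleftrightarrow> (\<forall>a b. u \<le> a \<and> a < b \<and> b \<le> v \<longrightarrow> has_colour C a b)"

lemma has_colour_mono: "has_colour C a b \<Longrightarrow> a' \<le> a \<Longrightarrow> b \<le> b' \<Longrightarrow> has_colour C a' b'"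
  unfolding has_colour_def by (blast intro: order_trans)

lemma dense_colours_mono:
  "dense_colours C u v \<Longrightarrow> u \<le> u' \<Longrightarrow> v' \<le> v \<Longrightarrow> dense_colours C u' v'"
  unfolding dense_colours_def by (blast intro: order_trans)

text \<open>Analogue of the fact that finite unions of nowhere dense sets are nowhere dense: the
  interval is shrunk once for each member of \<open>T\<close>.\<close>

lemma avoid_nowhere_dense:
  assumes "finite T" "u < v"
    and "\<And>s u' v'. s \<in> T \<Longrightarrow> u \<le> u' \<Longrightarrow> u' < v' \<Longrightarrow> v' \<le> v \<Longrightarrow> \<not> dense_colours (C s) u' v'"
  shows "\<exists>a b. u \<le> a \<and> a < b \<and> b \<le> v \<and> (\<forall>s\<in>T. \<not> has_colour (C s) a b)"
  using assms(1,3)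
proof (induction T rule: finite_induct)
  case empty
  then show ?case using \<open>u < v\<close> by auto
next
  case (insert t T)
  have "\<exists>a b. u \<le> a \<and> a < b \<and> b \<le> v \<and> (\<forall>s\<in>T. \<not> has_colour (C s) a b)"
    by (rule insert.IH) (use insert.prems in simp)
  then obtain a b where ab: "u \<le> a" "a < b" "b \<le> v" "\<forall>s\<in>T. \<not> has_colour (C s) a b"
    by blast
  have "\<not> dense_colours (C t) a b"
    using insert.prems ab by simp
  then obtain a' b' where ab': "a \<le> a'" "a' < b'" "b' \<le> b" "\<not> has_colour (C t) a' b'"
    unfolding dense_colours_def by blast
  have "\<forall>s\<in>insert t T. \<not> has_colour (C s) a' b'"
    using ab(4) ab' has_colour_mono by blast
  moreover have "u \<le> a'" "b' \<le> v"
    using ab ab' by auto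
  ultimately show ?case
    using ab'(2) by blast
qed

text \<open>A gap of the chain \<open>q 0, ..., q (m - 1)\<close> is encoded by the indices to its
  left, so that it also names a gap among the vertices chosen to copy this order.\<close>

definition cuts :: "(nat \<Rightarrow> rat) \<Rightarrow> nat \<Rightarrow> nat set set" where
  "cuts q m = {{i. i < m \<and> q i < r} | r. r \<notin> q ` {..<m}}"

lemma finite_cuts: "finite (cuts q m)"
  by (rule finite_subset[of _ "Pow {..<m}"]) (auto simp: cuts_def)

lemma cuts_Suc_restrict: "D \<in> cuts q (Suc m) \<Longrightarrow> D \<inter> {..<m} \<in> cuts q m"
  unfolding cuts_def by (auto simp: lessThan_Suc)

text \<open>\<open>C j\<close> collects the colours (open intervals) of which infinitely many vertices
  pass through node \<open>j\<close>.\<close>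

locale fair_tree =
  fixes child :: "nat \<Rightarrow> nat \<Rightarrow> bool" and X :: "nat \<Rightarrow> rat"
    and C :: "nat \<Rightarrow> (rat \<times> rat) set" and B :: "nat \<Rightarrow> nat"
  assumes root: "C 0 = UNIV"
    and many: "(a, b) \<in> C j \<Longrightarrow> a < b \<Longrightarrow> infinite {s. child j s \<and> a < X s \<and> X s < b}"
    and fair: "c \<in> C j \<Longrightarrow> T \<subseteq> Collect (child j) \<Longrightarrow> finite T \<Longrightarrow> B j < card T \<Longrightarrow> \<exists>s\<in>T. c \<in> C s"
begin

text \<open>Among infinitely many bad children, choose \<open>B j + 1\<close>. Some interval
  contains no colour of any of them, yet it contains a colour of \<open>j\<close>, which
  \<open>fair\<close> hands to one of them.\<close>

lemma finite_bad_children: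
  assumes "dense_colours (C j) u v" "u < v"
  shows "finite {s. child j s \<and> \<not> (\<exists>u' v'. u \<le> u' \<and> u' < v' \<and> v' \<le> v \<and> dense_colours (C s) u' v')}"
    (is "finite ?bad")
proof (rule ccontr)
  assume "infinite ?bad"
  then obtain T where T: "finite T" "card T = Suc (B j)" "T \<subseteq> ?bad"
    by (meson infinite_arbitrarily_large)
  have "\<exists>a b. u \<le> a \<and> a < b \<and> b \<le> v \<and> (\<forall>s\<in>T. \<not> has_colour (C s) a b)"
  proof (rule avoid_nowhere_dense[OF T(1) assms(2)])
    fix s u' v' assume "s \<in> T" "u \<le> u'" "u' < v'" "v' \<le> v"
    then show "\<not> dense_colours (C s) u' v'" using T(3) by blast
  qed
  then obtain a b where ab: "u \<le> a" "a < b" "b \<le> v" "\<forall>s\<in>T. \<not> has_colour (C s) a b"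
    by blast
  then have "has_colour (C j) a b"
    using assms(1) unfolding dense_colours_def by blast
  then obtain c d where cd: "(c, d) \<in> C j" "a \<le> c" "c < d" "d \<le> b"
    unfolding has_colour_def by blast
  have "T \<subseteq> Collect (child j)"
    using T(3) by auto
  moreover have "B j < card T"
    using T(2) by simp
  ultimately obtain s where "s \<in> T" "(c, d) \<in> C s"
    using fair[OF cd(1) _ T(1)] by blast
  then show False using ab(4) cd unfolding has_colour_def by blast
qed

section \<open>Building a branch in the order of an enumeration\<close>

definition separated :: "nat \<Rightarrow> (nat \<Rightarrow> rat) \<Rightarrow> nat set \<Rightarrow> rat \<Rightarrow> rat \<Rightarrow> bool" where
  "separated m x D u v \<longleftrightarrow> (\<forall>i<m. (i \<in> D \<longrightarrow> x i \<le> u) \<and> (i \<notin> D \<longrightarrow> v \<le> x i))"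

text \<open>The root \<open>t 0\<close> represents no rational: \<open>q i\<close> is copied by the
  vertex of \<open>t (Suc i)\<close>, whence the shift.\<close>

definition good :: "(nat \<Rightarrow> rat) \<Rightarrow> nat \<Rightarrow> (nat \<Rightarrow> nat) \<Rightarrow> bool" where
  "good q m t \<longleftrightarrow>
     (\<forall>D\<in>cuts q m. \<exists>u v. u < v \<and> separated m (\<lambda>i. X (t (Suc i))) D u v \<and> dense_colours (C (t m)) u v) \<and>
     (\<forall>i<m. child (t i) (t (Suc i))) \<and>
     (\<forall>i<m. \<forall>j<m. q i < q j \<longrightarrow> X (t (Suc i)) < X (t (Suc j)))"

text \<open>The interval kept in the gap of \<open>q m\<close> is divided in three: the middle part
  receives the new vertex, the outer parts serve the two gaps it creates. A colour in the middle
  offers infinitely many children, of which each of the finitely many gaps spoils only finitely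
  many.\<close>

lemma good_step:
  assumes "inj q" "good q m t"
  shows "\<exists>s. good q (Suc m) (t(Suc m := s))"
proof -
  define x where "x i = X (t (Suc i))" for i
  define D0 where "D0 = {i. i < m \<and> q i < q m}"
  have "q m \<notin> q ` {..<m}"
    using \<open>inj q\<close> by (auto simp: inj_eq)
  then have D0: "D0 \<in> cuts q m"
    unfolding cuts_def D0_def by auto
  have ex: "\<exists>u v. u < v \<and> separated m x D u v \<and> dense_colours (C (t m)) u v" if "D \<in> cuts q m" for D
    using assms(2) that unfolding good_def x_def by blast
  obtain u v where uv: "u < v" "separated m x D0 u v" "dense_colours (C (t m)) u v"
    using ex[OF D0] by blast
  obtain a where a: "u < a" "a < v" using dense uv(1) by blast
  obtain b where b: "a < b" "b < v" using dense a(2) by blast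
  obtain c d where cd: "(c, d) \<in> C (t m)" "a \<le> c" "c < d" "d \<le> b"
    using uv(3) a b unfolding dense_colours_def has_colour_def by (meson less_imp_le)
  have ex': "\<exists>u' v'. u' < v' \<and> separated m x D u' v' \<and> dense_colours (C (t m)) u' v' \<and>
      (m \<in> D \<longrightarrow> b \<le> u') \<and> (m \<notin> D \<longrightarrow> v' \<le> a)" if D: "D \<in> cuts q (Suc m)" for D
  proof -
    obtain r where r: "D = {i. i < Suc m \<and> q i < r}" "r \<notin> q ` {..<Suc m}"
      using D unfolding cuts_def by blast
    show ?thesis
    proof (cases "D \<inter> {..<m} = D0")
      case True
      have eq: "i \<in> D \<longleftrightarrow> i \<in> D0" if "i < m" for i
        using True that by blast
      show ?thesis
      proof (cases "m \<in> D")
        case True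
        have "separated m x D b v"
          using uv(2) eq a b unfolding separated_def by (meson le_less_trans less_imp_le)
        moreover have "dense_colours (C (t m)) b v"
          using dense_colours_mono[OF uv(3), of b v] a b by simp
        ultimately show ?thesis using True b by blast
      next
        case False
        have "separated m x D u a"
          using uv(2) eq a b unfolding separated_def by (meson less_le_trans less_imp_le)
        moreover have "dense_colours (C (t m)) u a"
          using dense_colours_mono[OF uv(3), of u a] a b by simp
        ultimately show ?thesis using False a by blast
      qed
    next
      case False
      obtain u' v' where uv': "u' < v'" "separated m x (D \<inter> {..<m}) u' v'"
          "dense_colours (C (t m)) u' v'"
        using ex[OF cuts_Suc_restrict[OF D]] by blast
      have sep: "separated m x D u' v'"
        using uv'(2) unfolding separated_def by auto
      \<comment> \<open>Here \<open>D\<close> is an old gap other than \<open>D0\<close>; a chain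
        point between the two gaps keeps its interval away from the middle part.\<close>
      have "b \<le> u'" if "m \<in> D"
      proof -
        have "q m < r" using that r by auto
        then have "D0 \<subseteq> D" using r D0_def by auto
        then obtain i where i: "i < m" "i \<in> D" "i \<notin> D0" using False D0_def by auto
        then have "x i \<le> u'" "v \<le> x i" using sep uv(2) unfolding separated_def by auto
        then show ?thesis using b by simp
      qed
      moreover have "v' \<le> a" if "m \<notin> D"
      proof -
        have "r < q m" using that r by (auto simp: lessThan_Suc)
        then have "D \<inter> {..<m} \<subseteq> D0" using r D0_def by auto
        then obtain i where i: "i < m" "i \<notin> D" "i \<in> D0" using False D0_def by auto
        then have "v' \<le> x i" "x i \<le> u" using sep uv(2) unfolding separated_def by auto
        then show ?thesis using a by simp
      qed
      ultimately show ?thesis using uv' sep by blast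
    qed
  qed
  then obtain U W where UW: "\<And>D. D \<in> cuts q (Suc m) \<Longrightarrow> U D < W D \<and> separated m x D (U D) (W D) \<and>
      dense_colours (C (t m)) (U D) (W D) \<and> (m \<in> D \<longrightarrow> b \<le> U D) \<and> (m \<notin> D \<longrightarrow> W D \<le> a)"
    by metis
  define bad where "bad D = {s. child (t m) s \<and>
      \<not> (\<exists>u' v'. U D \<le> u' \<and> u' < v' \<and> v' \<le> W D \<and> dense_colours (C s) u' v')}" for D
  have "finite (bad D)" if "D \<in> cuts q (Suc m)" for D
    unfolding bad_def using finite_bad_children UW[OF that] by blast
  then have "finite (\<Union>D\<in>cuts q (Suc m). bad D)"
    using finite_cuts by blast
  then have "infinite ({s. child (t m) s \<and> c < X s \<and> X s < d} - (\<Union>D\<in>cuts q (Suc m). bad D))"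
    using many[OF cd(1,3)] by (rule Diff_infinite_finite)
  then obtain s where "s \<in> {s. child (t m) s \<and> c < X s \<and> X s < d} - (\<Union>D\<in>cuts q (Suc m). bad D)"
    by (metis finite.emptyI ex_in_conv)
  then have s: "child (t m) s" "c < X s" "X s < d" "\<And>D. D \<in> cuts q (Suc m) \<Longrightarrow> s \<notin> bad D"
    by auto
  have Xs: "a < X s" "X s < b" using s cd by auto
  define t' where "t' = t(Suc m := s)"
  have t'_m: "t' (Suc m) = s" and t'_less: "\<And>i. i \<le> m \<Longrightarrow> t' i = t i"
    by (auto simp: t'_def)
  have x': "X (t' (Suc i)) = (if i = m then X s else x i)" if "i < Suc m" for i
    using that t'_m t'_less[of "Suc i"] by (auto simp: x_def)
  have "\<exists>u' v'. u' < v' \<and> separated (Suc m) (\<lambda>i. X (t' (Suc i))) D u' v' \<and>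
      dense_colours (C (t' (Suc m))) u' v'" if D: "D \<in> cuts q (Suc m)" for D
  proof -
    obtain u' v' where uv': "U D \<le> u'" "u' < v'" "v' \<le> W D" "dense_colours (C s) u' v'"
      using s(1) s(4)[OF D] unfolding bad_def by blast
    have "separated (Suc m) (\<lambda>i. X (t' (Suc i))) D u' v'"
      unfolding separated_def
    proof (intro allI impI)
      fix i assume i: "i < Suc m"
      show "(i \<in> D \<longrightarrow> X (t' (Suc i)) \<le> u') \<and> (i \<notin> D \<longrightarrow> v' \<le> X (t' (Suc i)))"
      proof (cases "i = m")
        case True
        then show ?thesis using x'[OF i] UW[OF D] Xs uv' by auto
      next
        case False
        then have "(i \<in> D \<longrightarrow> x i \<le> U D) \<and> (i \<notin> D \<longrightarrow> W D \<le> x i)"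
          using i UW[OF D] unfolding separated_def by auto
        then show ?thesis using x'[OF i] False uv' by auto
      qed
    qed
    then show ?thesis using uv' t'_m by blast
  qed
  moreover have "child (t' i) (t' (Suc i))" if "i < Suc m" for i
    using that assms(2) s(1) t'_m t'_less[of i] t'_less[of "Suc i"] unfolding good_def
    by (cases "i = m") auto
  moreover have "X (t' (Suc i)) < X (t' (Suc j))" if "i < Suc m" "j < Suc m" "q i < q j" for i j
  proof -
    have old: "x i < x j" if "i < m" "j < m" "q i < q j" for i j
      using assms(2) that unfolding good_def x_def by blast
    have left: "x i < X s" if "i < m" "q i < q m" for i
    proof -
      have "x i \<le> u" using that uv(2) unfolding separated_def D0_def by blast
      then show ?thesis using a Xs by simp
    qed
    have right: "X s < x i" if "i < m" "q m < q i" for i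
    proof -
      have "v \<le> x i" using that uv(2) unfolding separated_def D0_def by auto
      then show ?thesis using b Xs by simp
    qed
    show ?thesis
      using that x'[OF that(1)] x'[OF that(2)] old left right by (auto simp: less_Suc_eq)
  qed
  ultimately show ?thesis
    unfolding good_def t'_def by blast
qed

theorem dense_chain:
  fixes q :: "nat \<Rightarrow> rat"
  assumes "inj q"
  shows "\<exists>t. t 0 = 0 \<and> (\<forall>i. child (t i) (t (Suc i))) \<and>
    (\<forall>i j. q i < q j \<longrightarrow> X (t (Suc i)) < X (t (Suc j)))"
proof -
  have dense0: "dense_colours (C 0) u v" for u v
    unfolding dense_colours_def has_colour_def root by auto
  have "good q 0 (\<lambda>_. 0)"
    unfolding good_def separated_def using dense0 by (auto intro!: exI[of _ 0] gt_ex)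
  then have "\<exists>g. \<forall>m. (good q m (g m) \<and> g m 0 = 0) \<and> (\<exists>s. g (Suc m) = (g m)(Suc m := s))"
  proof (intro dependent_nat_choice)
    fix g m assume g: "good q m g \<and> g 0 = 0"
    then obtain s where "good q (Suc m) (g(Suc m := s))"
      using good_step[OF assms] by blast
    then show "\<exists>g'. (good q (Suc m) g' \<and> g' 0 = 0) \<and> (\<exists>s. g' = g(Suc m := s))"
      using g by (intro exI[of _ "g(Suc m := s)"]) auto
  qed blast
  then obtain g where g: "\<And>m. good q m (g m)" "\<And>m. g m 0 = 0"
      "\<And>m. \<exists>s. g (Suc m) = (g m)(Suc m := s)"
    by blast
  \<comment> \<open>Later steps change only entries of larger index, so the diagonal is the limit
    branch.\<close>
  have g_stable: "g (i + k) i = g i i" for i k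
  proof (induction k)
    case (Suc k)
    obtain s where "g (Suc (i + k)) = (g (i + k))(Suc (i + k) := s)"
      using g(3) by blast
    then show ?case using Suc by simp
  qed simp
  define t where "t i = g i i" for i
  have gt: "g m i = t i" if "i \<le> m" for m i
    using g_stable[of i "m - i"] that by (simp add: t_def)
  have "child (t i) (t (Suc i))" for i
    using g(1)[of "Suc i"] gt[of i "Suc i"] gt[of "Suc i" "Suc i"] unfolding good_def by auto
  moreover have "X (t (Suc i)) < X (t (Suc j))" if "q i < q j" for i j
  proof -
    define m where "m = Suc (max i j)"
    have "X (g m (Suc i)) < X (g m (Suc j))"
      using g(1)[of m] that unfolding good_def m_def by (simp add: less_Suc_eq_le)
    then show ?thesis using gt[of "Suc i" m] gt[of "Suc j" m] by (simp add: m_def)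
  qed
  ultimately show ?thesis using g(2) t_def by metis
qed

end

section \<open>The strategy\<close>

text \<open>The first component of \<open>prod_decode\<close> takes every value infinitely often, so
  each pair is the colour of infinitely many vertices.\<close>

definition colour :: "nat \<Rightarrow> rat \<times> rat" where
  "colour n = from_nat (fst (prod_decode n))"

lemma infinite_colour: "infinite {n. colour n = c}"
proof -
  have "inj (\<lambda>k. prod_encode (to_nat c, k))"
    by (simp add: inj_def)
  then have "infinite (range (\<lambda>k. prod_encode (to_nat c, k)))"
    by (simp add: finite_image_iff)
  moreover have "range (\<lambda>k. prod_encode (to_nat c, k)) \<subseteq> {n. colour n = c}"
    by (auto simp: colour_def)
  ultimately show ?thesis
    using finite_subset by blast
qed

text \<open>Colours include pairs that bound no interval; for these only freshness is
  demanded.\<close>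

definition fresh :: "rat set set \<Rightarrow> rat \<times> rat \<Rightarrow> rat" where
  "fresh E c = (SOME x. x \<notin> \<Union>E \<and> (fst c < snd c \<longrightarrow> fst c < x \<and> x < snd c))"

lemma fresh:
  assumes "finite (\<Union>E)"
  shows "fresh E c \<notin> \<Union>E" "fst c < snd c \<Longrightarrow> fst c < fresh E c \<and> fresh E c < snd c"
proof -
  have "\<exists>x. x \<notin> \<Union>E \<and> (fst c < snd c \<longrightarrow> fst c < x \<and> x < snd c)"
  proof (cases "fst c < snd c")
    case True
    then have "infinite ({fst c<..<snd c} - \<Union>E)"
      using assms by (intro Diff_infinite_finite) auto
    then have "{fst c<..<snd c} - \<Union>E \<noteq> {}"
      by (metis finite.emptyI)
    then show ?thesis by auto
  next
    case False
    then show ?thesis using assms ex_new_if_finite[OF infinite_UNIV_char_0] by blast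
  qed
  then have "fresh E c \<notin> \<Union>E \<and> (fst c < snd c \<longrightarrow> fst c < fresh E c \<and> fresh E c < snd c)"
    unfolding fresh_def by (rule someI_ex)
  then show "fresh E c \<notin> \<Union>E" "fst c < snd c \<Longrightarrow> fst c < fresh E c \<and> fresh E c < snd c"
    by blast+
qed

text \<open>Node \<open>i\<close> of the tree is the vertex \<open>vert i\<close>; nodes below \<open>num\<close> are placed, and
  the vertex with number \<open>num\<close> is being routed and has reached node \<open>cur\<close>. The value
  \<open>visits j c i\<close> counts the vertices of colour \<open>c\<close> that so far left node \<open>j\<close> towards its
  child \<open>i\<close> or, if \<open>i = j\<close>, became children of \<open>j\<close>.\<close>

record position =
  num :: nat
  vert :: "nat \<Rightarrow> rat"
  par :: "nat \<Rightarrow> nat"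
  cur :: nat
  visits :: "nat \<Rightarrow> rat \<times> rat \<Rightarrow> nat \<Rightarrow> nat"

definition routes :: "rat set set \<Rightarrow> position \<Rightarrow> nat set" where
  "routes E s = insert (cur s)
     {i. 0 < i \<and> i < num s \<and> par s i = cur s \<and> {vert s (num s), vert s i} \<notin> E}"

definition route :: "rat set set \<Rightarrow> position \<Rightarrow> nat" where
  "route E s = arg_min_on (\<lambda>i. i + visits s (cur s) (colour (num s)) i) (routes E s)"

text \<open>Taken after Maker has joined vertex \<open>num s\<close> to node \<open>cur s\<close>
  and Breaker has replied. The route \<open>cur s\<close> itself means stopping: the vertex becomes
  a child, and the next one starts at the root.\<close>

definition step :: "rat set set \<Rightarrow> position \<Rightarrow> position" where
  "step E s =
    (let r = route E s;
         s' = s\<lparr>visits := \<lambda>j c i. visits s j c i + of_bool (j = cur s \<and> c = colour (num s) \<and> i = r)\<rparr>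
     in if r = cur s
        then s'\<lparr>num := Suc (num s), vert := (vert s)(Suc (num s) := fresh E (colour (Suc (num s)))),
                par := (par s)(num s := cur s), cur := 0\<rparr>
        else s'\<lparr>cur := r\<rparr>)"

text \<open>The root is the rational 0. The set \<open>{{0}}\<close> stands in for the claimed
  edges, so that the first routed vertex differs from it.\<close>

definition start :: position where
  "start = \<lparr>num = 1, vert = (\<lambda>_. 0)(1 := fresh {{0}} (colour 1)), par = \<lambda>_. 0, cur = 0,
     visits = \<lambda>_ _ _. 0\<rparr>"

section \<open>From positions to a strategy\<close>

primrec run :: "(nat \<Rightarrow> rat set) \<Rightarrow> nat \<Rightarrow> position" where
  "run p 0 = start"
| "run p (Suc k) = step (p ` {..<2 * k + 2}) (run p k)"

definition move :: "position \<Rightarrow> rat set" where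
  "move s = {vert s (num s), vert s (cur s)}"

definition strategy :: "rat set list \<Rightarrow> rat set" where
  "strategy h = move (run ((!) h) (length h div 2))"

text \<open>Position \<open>k\<close> depends only on the first \<open>2 * k\<close> moves, so it
  can be computed from a history whose entries beyond its length are unspecified.\<close>

lemma run_cong: "(\<And>i. i < 2 * k \<Longrightarrow> p i = q i) \<Longrightarrow> run p k = run q k"
proof (induction k)
  case (Suc k)
  have "p ` {..<2 * k + 2} = q ` {..<2 * k + 2}"
    using Suc.prems by (intro image_cong) auto
  then show ?case using Suc by simp
qed simp

lemma strategy_run: "strategy (map p [0..<2 * k]) = move (run p k)"
proof -
  have "run ((!) (map p [0..<2 * k])) k = run p k"
    by (rule run_cong) simp
  then show ?thesis by (simp add: strategy_def)
qed

lemma finite_routes: "finite (routes E s)"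
  by (simp add: routes_def)

lemma route_in: "route E s \<in> routes E s"
  unfolding route_def using finite_routes
  by (intro arg_min_if_finite) (auto simp: routes_def)

lemma route_le:
  "i \<in> routes E s \<Longrightarrow>
    route E s + visits s (cur s) (colour (num s)) (route E s) \<le> i + visits s (cur s) (colour (num s)) i"
  unfolding route_def using finite_routes by (intro arg_min_least) auto

text \<open>The weight \<open>i + visits\<close> makes every vertex prefer a child that was chosen only
  finitely often, as soon as it is available.\<close>

lemma least_weight_infinitely_often:
  fixes r :: "nat \<Rightarrow> nat"
  assumes "infinite V" "finite T"
    and le: "\<And>k i. k \<in> V \<Longrightarrow> i \<in> A k \<Longrightarrow>
      r k + card {l\<in>V. l < k \<and> r l = r k} \<le> i + card {l\<in>V. l < k \<and> r l = i}"
    and avail: "\<And>k. k \<in> V \<Longrightarrow> k0 \<le> k \<Longrightarrow> T \<inter> A k \<noteq> {}"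
  shows "\<exists>i\<in>T. infinite {k\<in>V. r k = i}"
proof (rule ccontr)
  assume "\<not> ?thesis"
  then have fin: "finite {k\<in>V. r k = i}" if "i \<in> T" for i
    using that by blast
  define M where "M = (\<Sum>i\<in>T. i + card {k\<in>V. r k = i})"
  \<comment> \<open>A choice together with its number of earlier occurrences determines the time.
    From \<open>k0\<close> on such pairs lie in a finite square, which contradicts the infinity of
    \<open>V\<close>.\<close>
  define w where "w k = (r k, card {l\<in>V. l < k \<and> r l = r k})" for k
  have bound: "r k + card {l\<in>V. l < k \<and> r l = r k} \<le> M" if k: "k \<in> V" "k0 \<le> k" for k
  proof -
    obtain i where i: "i \<in> T" "i \<in> A k" using avail[OF k] by blast
    have "card {l\<in>V. l < k \<and> r l = i} \<le> card {k\<in>V. r k = i}"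
      using fin[OF i(1)] by (intro card_mono) auto
    then have "i + card {l\<in>V. l < k \<and> r l = i} \<le> i + card {k\<in>V. r k = i}"
      by simp
    also have "\<dots> \<le> M"
      unfolding M_def using member_le_sum[OF i(1), of "\<lambda>i. i + card {k\<in>V. r k = i}"] \<open>finite T\<close>
      by simp
    finally show ?thesis using le[OF k(1) i(2)] by simp
  qed
  have lt: "w k \<noteq> w k'" if "k \<in> V" "k < k'" for k k'
  proof
    assume "w k = w k'"
    then have r: "r k = r k'" and
      c: "card {l\<in>V. l < k \<and> r l = r k} = card {l\<in>V. l < k' \<and> r l = r k'}"
      by (auto simp: w_def)
    have "{l\<in>V. l < k \<and> r l = r k} \<subset> {l\<in>V. l < k' \<and> r l = r k'}"
      using that r by auto
    then have "card {l\<in>V. l < k \<and> r l = r k} < card {l\<in>V. l < k' \<and> r l = r k'}"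
      by (intro psubset_card_mono) auto
    then show False using c by simp
  qed
  have "inj_on w (V \<inter> {k0..})"
    using lt by (intro inj_onI) (metis IntD1 linorder_neqE_nat)
  moreover have "w ` (V \<inter> {k0..}) \<subseteq> {..M} \<times> {..M}"
    using bound by (force simp: w_def)
  then have "finite (w ` (V \<inter> {k0..}))"
    using finite_subset by blast
  ultimately have "finite (V \<inter> {k0..})"
    using finite_imageD by blast
  then have "finite (V \<inter> {k0..} \<union> {..<k0})"
    by simp
  moreover have "V \<subseteq> V \<inter> {k0..} \<union> {..<k0}"
    by auto
  ultimately show False
    using \<open>infinite V\<close> finite_subset by blast
qed

section \<open>Analysis of a play\<close>

locale play =
  fixes p :: "nat \<Rightarrow> rat set"
  assumes maker: "p (2 * k) = move (run p k)"
    and breaker: "is_edge (p (2 * k + 1))"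
begin

abbreviation "N k \<equiv> num (run p k)"
abbreviation "J k \<equiv> cur (run p k)"
abbreviation "claimed k \<equiv> p ` {..<2 * k + 2}"
abbreviation "R k \<equiv> route (claimed k) (run p k)"

section \<open>Invariants of the positions\<close>

lemma finite_edge: "finite (p m)"
proof (cases "even m")
  case True
  then show ?thesis using maker by (auto elim!: evenE simp: move_def)
next
  case False
  then obtain k where "m = 2 * k + 1" by (blast elim: oddE)
  then show ?thesis using breaker[of k] by (auto simp: is_edge_def)
qed

lemma finite_claimed: "finite (\<Union>(claimed k))"
  using finite_edge by blast

lemma step_stop:
  assumes "R k = J k"
  shows "N (Suc k) = Suc (N k)" "J (Suc k) = 0" "par (run p (Suc k)) = (par (run p k))(N k := J k)"
    "vert (run p (Suc k)) = (vert (run p k))(Suc (N k) := fresh (claimed k) (colour (Suc (N k))))"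
  using assms by (simp_all add: step_def Let_def)

lemma step_go:
  assumes "R k \<noteq> J k"
  shows "N (Suc k) = N k" "J (Suc k) = R k" "par (run p (Suc k)) = par (run p k)"
    "vert (run p (Suc k)) = vert (run p k)"
  using assms by (simp_all add: step_def Let_def)

text \<open>Turns the counters into the cardinalities used in
  \<open>least_weight_infinitely_often\<close>.\<close>

lemma visits_eq:
  "visits (run p k) j c i = card {l. l < k \<and> J l = j \<and> colour (N l) = c \<and> R l = i}"
proof (induction k)
  case 0
  then show ?case by (simp add: start_def)
next
  case (Suc k)
  have "{l. l < Suc k \<and> J l = j \<and> colour (N l) = c \<and> R l = i} =
      {l. l < k \<and> J l = j \<and> colour (N l) = c \<and> R l = i} \<union>
      (if j = J k \<and> c = colour (N k) \<and> i = R k then {k} else {})"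
    by (auto simp: less_Suc_eq)
  then have "card {l. l < Suc k \<and> J l = j \<and> colour (N l) = c \<and> R l = i} =
      card {l. l < k \<and> J l = j \<and> colour (N l) = c \<and> R l = i} +
      of_bool (j = J k \<and> c = colour (N k) \<and> i = R k)"
    by auto
  moreover have "visits (run p (Suc k)) j c i =
      visits (run p k) j c i + of_bool (j = J k \<and> c = colour (N k) \<and> i = R k)"
    by (simp add: step_def Let_def)
  ultimately show ?case using Suc by simp
qed

lemma route_child:
  assumes "R k \<noteq> J k"
  shows "0 < R k" "R k < N k" "par (run p k) (R k) = J k"
    "{vert (run p k) (N k), vert (run p k) (R k)} \<notin> claimed k"
  using assms route_in[of "claimed k" "run p k"] by (auto simp: routes_def)

lemma cur_less_num: "J k < N k"
proof (induction k)
  case 0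
  then show ?case by (simp add: start_def)
next
  case (Suc k)
  then show ?case
    using step_stop[of k] step_go[of k] route_child[of k] by (cases "R k = J k") auto
qed

text \<open>A vertex is attached to a node placed before it. Hence node numbers increase along a
  routing, which therefore ends.\<close>

lemma par_less: "0 < i \<Longrightarrow> i < N k \<Longrightarrow> par (run p k) i < i"
proof (induction k)
  case 0
  then show ?case by (simp add: start_def)
next
  case (Suc k)
  then show ?case
    using step_stop[of k] step_go[of k] cur_less_num[of k]
    by (cases "R k = J k") (auto simp: less_Suc_eq)
qed

lemma cur_less_route: "R k \<noteq> J k \<Longrightarrow> J k < R k"
  using route_child[of k] par_less[of "R k" k] by auto

lemma vert_colour:
  assumes "0 < i" "i \<le> N k" "fst (colour i) < snd (colour i)"
  shows "fst (colour i) < vert (run p k) i \<and> vert (run p k) i < snd (colour i)"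
  using assms(2)
proof (induction k)
  case 0
  then have "i = 1" using assms(1) by (simp add: start_def)
  then show ?case using fresh(2)[of "{{0}}" "colour i"] assms(3) by (simp add: start_def)
next
  case (Suc k)
  show ?case
  proof (cases "R k = J k")
    case True
    then show ?thesis
      using Suc step_stop[OF True] fresh(2)[OF finite_claimed, of "colour i"] assms(3)
      by (cases "i = Suc (N k)") (simp_all del: run.simps)
  next
    case False
    then show ?thesis using Suc step_go[OF False] by simp
  qed
qed

text \<open>Maker's move contains the vertex being routed. Thus a vertex avoiding all claimed edges
  differs from all earlier ones.\<close>

lemma vert_touched: "i \<le> N k \<Longrightarrow> \<exists>m\<le>2 * k. vert (run p k) i \<in> p m"
proof (induction k)
  case 0
  have "i = 0 \<or> i = 1" using 0 by (auto simp: start_def)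
  then show ?case using maker[of 0] by (auto simp: start_def move_def)
next
  case (Suc k)
  have new: "vert (run p (Suc k)) (N (Suc k)) \<in> p (2 * Suc k)"
    unfolding maker by (simp add: move_def)
  show ?case
  proof (cases "i \<le> N k")
    case True
    then have "vert (run p (Suc k)) i = vert (run p k) i"
      using step_stop[of k] step_go[of k] by (cases "R k = J k") (auto simp del: run.simps)
    moreover obtain m where "m \<le> 2 * k" "vert (run p k) i \<in> p m" using Suc.IH[OF True] by blast
    ultimately show ?thesis by (intro exI[of _ m]) simp
  next
    case False
    then have "i = N (Suc k)"
      using Suc.prems step_stop[of k] step_go[of k] by (cases "R k = J k") auto
    then show ?thesis using new by blast
  qed
qed

lemma inj_vert: "inj_on (vert (run p k)) {..N k}"
proof (induction k)
  case 0
  have "fresh {{0}} (colour 1) \<noteq> 0" using fresh(1)[of "{{0}}"] by simp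
  moreover have "{..Suc 0} = {0, 1}" by auto
  ultimately show ?case by (simp add: start_def)
next
  case (Suc k)
  show ?case
  proof (cases "R k = J k")
    case True
    define x where "x = fresh (claimed k) (colour (Suc (N k)))"
    have "vert (run p k) i \<in> \<Union>(claimed k)" if i: "i \<le> N k" for i
    proof -
      obtain m where "m \<le> 2 * k" "vert (run p k) i \<in> p m" using vert_touched[OF i] by blast
      then show ?thesis by (intro UnionI[of "p m"]) auto
    qed
    moreover have "x \<notin> \<Union>(claimed k)"
      unfolding x_def by (rule fresh(1)[OF finite_claimed])
    ultimately have "x \<notin> vert (run p k) ` {..N k}"
      by blast
    moreover have "vert (run p (Suc k)) = (vert (run p k))(Suc (N k) := x)"
      using step_stop(4)[OF True] by (simp add: x_def)
    moreover have "{..N (Suc k)} = insert (Suc (N k)) {..N k}"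
      using step_stop(1)[OF True] by auto
    ultimately show ?thesis
      using Suc by (auto simp: inj_on_def simp del: run.simps)
  next
    case False
    then show ?thesis using Suc step_go[OF False] by simp
  qed
qed

text \<open>A vertex is fresh when its routing starts, and \<open>cur\<close> increases with every move of the
  routing; so \<open>cur\<close> bounds the number of rounds played since then.\<close>

lemma touched_le: "card {m. m < 2 * k \<and> vert (run p k) (N k) \<in> p m} \<le> 2 * J k"
proof (induction k)
  case (Suc k)
  show ?case
  proof (cases "R k = J k")
    case True
    have "fresh (claimed k) (colour (Suc (N k))) \<notin> \<Union>(claimed k)"
      by (rule fresh(1)[OF finite_claimed])
    then have "vert (run p (Suc k)) (N (Suc k)) \<notin> \<Union>(claimed k)"
      using step_stop[OF True] by simp
    then have "{m. m < 2 * Suc k \<and> vert (run p (Suc k)) (N (Suc k)) \<in> p m} = {}"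
      by auto
    then show ?thesis by (metis card.empty le0)
  next
    case False
    let ?x = "vert (run p k) (N k)"
    have eq: "vert (run p (Suc k)) (N (Suc k)) = ?x"
      using step_go[OF False] by simp
    have "{m. m < 2 * Suc k \<and> ?x \<in> p m} \<subseteq> {m. m < 2 * k \<and> ?x \<in> p m} \<union> {2 * k, 2 * k + 1}"
      by auto
    then have "card {m. m < 2 * Suc k \<and> ?x \<in> p m} \<le>
        card ({m. m < 2 * k \<and> ?x \<in> p m} \<union> {2 * k, 2 * k + 1})"
      by (intro card_mono) auto
    also have "\<dots> \<le> card {m. m < 2 * k \<and> ?x \<in> p m} + card {2 * k, 2 * k + 1}"
      by (rule card_Un_le)
    also have "\<dots> \<le> 2 * J k + 2"
      using Suc by simp
    also have "\<dots> \<le> 2 * J (Suc k)"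
      using cur_less_route[OF False] step_go[OF False] by simp
    finally show ?thesis unfolding eq .
  qed
qed simp

text \<open>Distinct nodes give distinct edges at the routed vertex, hence distinct moves touching
  it; the current round adds at most two to the bound of \<open>touched_le\<close>.\<close>

lemma blocked_le:
  "card {i. i < N k \<and> {vert (run p k) (N k), vert (run p k) i} \<in> claimed k} \<le> 2 * J k + 2"
    (is "card ?S \<le> _")
proof -
  let ?v = "vert (run p k)" and ?x = "vert (run p k) (N k)"
  have "\<forall>i\<in>?S. \<exists>m. m < 2 * k + 2 \<and> p m = {?x, ?v i}"
    by auto
  from bchoice[OF this] obtain f
    where f: "\<And>i. i \<in> ?S \<Longrightarrow> f i < 2 * k + 2 \<and> p (f i) = {?x, ?v i}"
    by blast
  have "inj_on f ?S"
  proof (rule inj_onI)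
    fix i j assume ij: "i \<in> ?S" "j \<in> ?S" "f i = f j"
    then have "{?x, ?v i} = {?x, ?v j}" using f[OF ij(1)] f[OF ij(2)] by simp
    then have "?v i = ?v j" by (auto simp: doubleton_eq_iff)
    then show "i = j" using ij inj_vert[of k] by (auto dest: inj_onD)
  qed
  moreover have "f ` ?S \<subseteq> {m. m < 2 * k \<and> ?x \<in> p m} \<union> {2 * k, 2 * k + 1}"
  proof
    fix m assume "m \<in> f ` ?S"
    then obtain i where "i \<in> ?S" "m = f i" by blast
    then have "m < 2 * k + 2" "?x \<in> p m" using f[of i] by auto
    then show "m \<in> {m. m < 2 * k \<and> ?x \<in> p m} \<union> {2 * k, 2 * k + 1}" by auto
  qed
  ultimately have "card ?S \<le> card ({m. m < 2 * k \<and> ?x \<in> p m} \<union> {2 * k, 2 * k + 1})"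
    by (intro card_inj_on_le) auto
  also have "\<dots> \<le> card {m. m < 2 * k \<and> ?x \<in> p m} + card {2 * k, 2 * k + 1}"
    by (rule card_Un_le)
  finally show ?thesis using touched_le[of k] by simp
qed

text \<open>After a stop the new vertex is fresh; otherwise the route was chosen with its edge
  unclaimed.\<close>

lemma maker_legal: "legal_move p (2 * k)"
proof -
  have "vert (run p k) (N k) \<noteq> vert (run p k) (J k)"
    using inj_vert[of k] cur_less_num[of k] by (auto dest!: inj_onD)
  then have "is_edge (p (2 * k))"
    unfolding is_edge_def maker move_def by blast
  moreover have "p (2 * k) \<notin> p ` {..<2 * k}"
  proof (cases k)
    case (Suc l)
    have eq: "p ` {..<2 * k} = claimed l" using Suc by simp
    show ?thesis
    proof (cases "R l = J l")
      case True
      have "vert (run p k) (N k) = fresh (claimed l) (colour (Suc (N l)))"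
        using step_stop[OF True] Suc by simp
      then have "vert (run p k) (N k) \<notin> \<Union>(claimed l)"
        using fresh(1)[OF finite_claimed] by metis
      then show ?thesis unfolding eq maker move_def by blast
    next
      case False
      then show ?thesis
        unfolding eq maker move_def using step_go[OF False] route_child(4)[OF False] Suc by simp
    qed
  qed simp
  ultimately show ?thesis by (simp add: legal_move_def)
qed

section \<open>The limit tree\<close>

lemma num_Suc: "N k \<le> N (Suc k)" "N (Suc k) \<le> Suc (N k)"
  using step_stop(1)[of k] step_go(1)[of k] by (cases "R k = J k"; simp)+

lemma num_mono: "k \<le> l \<Longrightarrow> N k \<le> N l"
  by (rule lift_Suc_mono_le[of N]) (rule num_Suc)

lemma vert_stable: "k \<le> l \<Longrightarrow> i \<le> N k \<Longrightarrow> vert (run p l) i = vert (run p k) i"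
proof (induction l rule: dec_induct)
  case (step l)
  then have "i \<le> N l" using num_mono[of k l] by simp
  then show ?case
    using step step_stop(4)[of l] step_go(4)[of l] by (cases "R l = J l") (auto simp del: run.simps)
qed simp

lemma par_stable: "k \<le> l \<Longrightarrow> i < N k \<Longrightarrow> par (run p l) i = par (run p k) i"
proof (induction l rule: dec_induct)
  case (step l)
  then have "i < N l" using num_mono[of k l] by simp
  then show ?case
    using step step_stop(3)[of l] step_go(3)[of l] by (cases "R l = J l") (auto simp del: run.simps)
qed simp

text \<open>If \<open>num\<close> were bounded, from some round on no routing would stop; then
  \<open>cur\<close> would grow in every round while staying below \<open>num\<close>.\<close>

lemma num_unbounded: "\<exists>k. i \<le> N k"
proof (rule ccontr)
  assume "\<not> ?thesis"
  then have less: "N k < i" for k by (simp add: not_le)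
  then have "finite (range N)"
    by (intro finite_subset[of "range N" "{..<i}"]) auto
  then obtain k where k: "N k = Max (range N)"
    using Max_in[of "range N"] by (metis (no_types) UNIV_not_empty image_is_empty imageE)
  have max: "N l \<le> N k" for l
    using \<open>finite (range N)\<close> k by simp
  have go: "R l \<noteq> J l" if "k \<le> l" for l
    using max[of "Suc l"] num_mono[OF that] step_stop(1)[of l] by force
  have "m \<le> J (k + m)" for m
  proof (induction m)
    case (Suc m)
    then show ?case
      using go[of "k + m"] step_go(2)[of "k + m"] cur_less_route[of "k + m"] by simp
  qed simp
  from this[of "N k"] have "N k < N k"
    using cur_less_num[of "k + N k"] max[of "k + N k"] by linarith
  then show False by simp
qed

definition X :: "nat \<Rightarrow> rat" where
  "X i = vert (run p (LEAST k. i \<le> N k)) i"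

definition child :: "nat \<Rightarrow> nat \<Rightarrow> bool" where
  "child j i \<longleftrightarrow> 0 < i \<and> (\<exists>k. i < N k \<and> par (run p k) i = j)"

lemma vert_eq_X: "i \<le> N k \<Longrightarrow> vert (run p k) i = X i"
  unfolding X_def by (rule vert_stable) (auto intro: Least_le LeastI)

lemma child_iff: "0 < i \<Longrightarrow> i < N k \<Longrightarrow> child j i \<longleftrightarrow> par (run p k) i = j"
  unfolding child_def using par_stable by (metis nat_le_linear)

lemma maker_edge: "{X (N k), X (J k)} \<in> maker_edges p"
proof -
  have "p (2 * k) = {X (N k), X (J k)}"
    using vert_eq_X[of "N k" k] vert_eq_X[of "J k" k] cur_less_num[of k]
    by (simp add: maker move_def)
  then show ?thesis unfolding maker_edges_def by force
qed

lemma N_start: "N 0 = 1" "J 0 = 0"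
  by (simp_all add: start_def)

section \<open>Branches span complete graphs\<close>

lemma start_of_routing: "0 < i \<Longrightarrow> \<exists>k. N k = i \<and> J k = 0"
proof (induction i)
  case (Suc i)
  show ?case
  proof (cases "i = 0")
    case True
    then show ?thesis using N_start by (intro exI[of _ 0]) simp
  next
    case False
    define k where "k = (LEAST k. Suc i \<le> N k)"
    have k: "Suc i \<le> N k"
      unfolding k_def using num_unbounded by (rule LeastI_ex)
    then have "k \<noteq> 0" using False N_start by (metis One_nat_def Suc_le_mono le_zero_eq)
    then obtain l where l: "k = Suc l" by (cases k) auto
    have "\<not> Suc i \<le> N l"
      using not_less_Least[of l "\<lambda>k. Suc i \<le> N k"] l k_def by simp
    then have "N l < N k" "N k = Suc i"
      using k num_Suc[of l] l by auto
    then have "R l = J l" using step_go(1)[of l] l by (metis less_irrefl)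
    then show ?thesis using step_stop(2) \<open>N k = Suc i\<close> l by blast
  qed
qed simp

lemma visited_child:
  assumes "child j i"
  shows "\<exists>k. N k = i \<and> J k = j \<and> R k = j"
proof -
  define k where "k = (LEAST k. i < N k)"
  have i: "0 < i" using assms child_def by simp
  have k: "i < N k"
    unfolding k_def using num_unbounded[of "Suc i", unfolded Suc_le_eq] by (rule LeastI_ex)
  then have "k \<noteq> 0" using i N_start by (metis less_one not_less_iff_gr_or_eq)
  then obtain l where l: "k = Suc l" by (cases k) auto
  have "\<not> i < N l"
    using not_less_Least[of l "\<lambda>k. i < N k"] l k_def by simp
  then have il: "N l = i" "N l < N k"
    using k num_Suc[of l] l by auto
  then have stop: "R l = J l" using step_go(1)[of l] l by (metis less_irrefl)
  have "par (run p k) i = J l"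
    using step_stop(3)[OF stop] l il by simp
  then have "J l = j" using child_iff[OF i k] assms by simp
  then show ?thesis using il stop by metis
qed

text \<open>A vertex at a node other than the root was at the parent of that node one round
  earlier.\<close>

lemma visited_parent:
  assumes "N k = i" "J k = j" "child j' j"
  shows "\<exists>k. N k = i \<and> J k = j'"
proof -
  have j: "0 < j" using assms(3) child_def by simp
  then have "k \<noteq> 0" using assms(2) N_start(2) by (intro notI) simp
  then obtain l where l: "k = Suc l" by (cases k) auto
  have go: "R l \<noteq> J l" using step_stop(2)[of l] j l assms(2) by force
  then have "J k = R l" "N k = N l" using step_go l by auto
  moreover have "child (J l) (R l)"
    using route_child[OF go] child_iff by blast
  ultimately have "J l = j'"
    using assms route_child[OF go] child_iff by metis
  then show ?thesis using \<open>N k = N l\<close> assms by metis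
qed

text \<open>When vertex \<open>t b\<close> stopped, it was at its parent. Tracing its route back
  along the branch reaches a round at \<open>t a\<close>, where Maker's move is the required
  edge.\<close>

lemma chain_complete:
  assumes "\<And>i. child (t i) (t (Suc i))" "a < b"
  shows "{X (t b), X (t a)} \<in> maker_edges p"
proof -
  obtain b' where b': "b = Suc b'" "a \<le> b'" using assms(2) by (cases b) auto
  have "\<exists>k. N k = t b \<and> J k = t a"
    using b'(2)
  proof (induction a rule: inc_induct)
    case base
    then show ?case using visited_child[OF assms(1)] b' by blast
  next
    case (step n)
    then show ?case using visited_parent[OF _ _ assms(1)] by blast
  qed
  then show ?thesis using maker_edge by metis
qed

section \<open>Fair distribution of colours\<close>

definition through :: "nat \<Rightarrow> rat \<times> rat \<Rightarrow> nat set" where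
  "through j c = {k. J k = j \<and> colour (N k) = c}"

lemma routed_infinitely_often:
  assumes "infinite (through j c)" "finite T"
    and "\<And>k. k \<in> through j c \<Longrightarrow> k0 \<le> k \<Longrightarrow> T \<inter> routes (claimed k) (run p k) \<noteq> {}"
  shows "\<exists>i\<in>T. infinite {k\<in>through j c. R k = i}"
proof (rule least_weight_infinitely_often[OF assms(1,2) _ assms(3)])
  fix k i assume k: "k \<in> through j c" and i: "i \<in> routes (claimed k) (run p k)"
  have "visits (run p k) j c i = card {l\<in>through j c. l < k \<and> R l = i}" for i
    unfolding visits_eq through_def by (rule arg_cong[of _ _ card]) auto
  then show "R k + card {l\<in>through j c. l < k \<and> R l = R k} \<le> i + card {l\<in>through j c. l < k \<and> R l = i}"
    using route_le[OF i] k by (simp add: through_def)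
qed

text \<open>Stopping is always available, so the choice of \<open>j\<close> itself recurs infinitely
  often; each stop adds a child.\<close>

lemma infinite_children:
  assumes "infinite (through j (a, b))" "a < b"
  shows "infinite {i. child j i \<and> a < X i \<and> X i < b}"
proof -
  define K where "K = {k\<in>through j (a, b). R k = j}"
  have "\<exists>i\<in>{j}. infinite {k\<in>through j (a, b). R k = i}"
    by (rule routed_infinitely_often[OF assms(1)]) (auto simp: routes_def through_def)
  then have "infinite K" by (simp add: K_def)
  moreover have "inj_on N K"
  proof (rule linorder_inj_onI')
    fix k l assume "k \<in> K" "l \<in> K" "k < l"
    then have "N (Suc k) = Suc (N k)" by (intro step_stop) (auto simp: K_def through_def)
    then show "N k \<noteq> N l" using num_mono[of "Suc k" l] \<open>k < l\<close> by simp
  qed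
  ultimately have "infinite (N ` K)"
    using finite_imageD by blast
  moreover have "N ` K \<subseteq> {i. child j i \<and> a < X i \<and> X i < b}"
  proof
    fix i assume "i \<in> N ` K"
    then obtain k where k: "i = N k" "J k = j" "colour i = (a, b)" "R k = J k"
      by (auto simp: K_def through_def)
    have pos: "0 < i" using k cur_less_num[of k] by simp
    have "child j i"
      using step_stop[OF k(4)] k pos unfolding child_def by (intro conjI exI[of _ "Suc k"]) auto
    moreover have "a < X i \<and> X i < b"
      using vert_colour[OF pos, of k] vert_eq_X[of i k] k assms(2) by simp
    ultimately show "i \<in> {i. child j i \<and> a < X i \<and> X i < b}" by simp
  qed
  ultimately show ?thesis using finite_subset by blast
qed

text \<open>Once all of \<open>T\<close> is placed, \<open>blocked_le\<close> leaves some member of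
  \<open>T\<close> open to each vertex passing \<open>j\<close>, so one member is chosen infinitely
  often.\<close>

lemma fair_routing:
  assumes "infinite (through j c)" "T \<subseteq> Collect (child j)" "finite T" "2 * j + 2 < card T"
  shows "\<exists>i\<in>T. infinite (through i c)"
proof -
  obtain k0 where k0: "Suc (Max T) \<le> N k0" using num_unbounded by blast
  have avail: "T \<inter> routes (claimed k) (run p k) \<noteq> {}" if k: "k \<in> through j c" "k0 \<le> k" for k
  proof
    assume empty: "T \<inter> routes (claimed k) (run p k) = {}"
    have "T \<subseteq> {i. i < N k \<and> {vert (run p k) (N k), vert (run p k) i} \<in> claimed k}"
    proof
      fix i assume i: "i \<in> T"
      then have "i \<le> Max T" using assms(3) by simp
      then have less: "i < N k" using k0 num_mono[OF k(2)] by simp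
      have "child j i" using i assms(2) by blast
      then have "0 < i" "par (run p k) i = J k"
        using child_iff[OF _ less] k(1) by (auto simp: child_def through_def)
      then show "i \<in> {i. i < N k \<and> {vert (run p k) (N k), vert (run p k) i} \<in> claimed k}"
        using empty i less by (auto simp: routes_def)
    qed
    then have "card T \<le> card {i. i < N k \<and> {vert (run p k) (N k), vert (run p k) i} \<in> claimed k}"
      by (intro card_mono) auto
    also have "\<dots> \<le> 2 * J k + 2"
      by (rule blocked_le)
    finally have "card T \<le> 2 * J k + 2" .
    with assms(4) k(1) show False by (simp add: through_def)
  qed
  obtain i where i: "i \<in> T" "infinite {k\<in>through j c. R k = i}"
    using routed_infinitely_often[OF assms(1,3) avail] by blast
  obtain k1 where k1: "i < N k1" using num_unbounded[of "Suc i"] by (auto simp: Suc_le_eq)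
  have "child j i" using i(1) assms(2) by blast
  then have "i \<noteq> j"
    using child_iff[OF _ k1] par_less[OF _ k1] by (auto simp: child_def)
  \<comment> \<open>As \<open>i\<close> differs from \<open>j\<close>, choosing it is a move and not
    a stop: the same vertex is at \<open>i\<close> in the next round.\<close>
  then have "Suc ` {k\<in>through j c. R k = i} \<subseteq> through i c"
    using step_go by (auto simp: through_def simp del: run.simps)
  moreover have "infinite (Suc ` {k\<in>through j c. R k = i})"
    using i(2) by (simp add: finite_image_iff)
  ultimately show ?thesis using i(1) finite_subset by blast
qed

lemma through_root: "infinite (through 0 c)"
proof -
  \<comment> \<open>Number 0 is the root, placed from the outset and never routed.\<close>
  have "{i. colour i = c} - {0} \<subseteq> N ` through 0 c"
  proof
    fix i assume "i \<in> {i. colour i = c} - {0}"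
    then obtain k where "N k = i" "J k = 0" "colour i = c" using start_of_routing[of i] by auto
    then show "i \<in> N ` through 0 c" by (auto simp: through_def)
  qed
  moreover have "infinite ({i. colour i = c} - {0})"
    using infinite_colour by simp
  ultimately show ?thesis using finite_subset finite_imageI by metis
qed

sublocale fair_tree child X "\<lambda>j. {c. infinite (through j c)}" "\<lambda>j. 2 * j + 2"
  using through_root infinite_children fair_routing by unfold_locales auto

text \<open>A branch following an enumeration of all rationals yields the order embedding
  \<open>f\<close>; its range is the required copy.\<close>

lemma maker_wins: "maker_wins p"
proof -
  define q :: "nat \<Rightarrow> rat" where "q = from_nat_into UNIV"
  have q: "bij q"
    unfolding q_def by (rule bij_betw_from_nat_into) (auto simp: infinite_UNIV_char_0)
  obtain t where t: "\<And>i. child (t i) (t (Suc i))"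
      "\<And>i j. q i < q j \<Longrightarrow> X (t (Suc i)) < X (t (Suc j))"
    using dense_chain[OF bij_is_inj[OF q]] by blast
  define f where "f r = X (t (Suc (inv q r)))" for r
  have "strict_mono f"
    using t(2) bij_is_surj[OF q] by (intro strict_monoI) (simp add: f_def surj_f_inv_f)
  moreover have "{f r, f r'} \<in> maker_edges p" if "f r \<noteq> f r'" for r r'
  proof -
    have edge: "{X (t (Suc a)), X (t (Suc b))} \<in> maker_edges p" if "a < b" for a b
      using chain_complete[of t "Suc a" "Suc b"] t(1) that by (simp add: insert_commute)
    have "inv q r \<noteq> inv q r'" using that by (auto simp: f_def)
    then show ?thesis
      using edge[of "inv q r" "inv q r'"] edge[of "inv q r'" "inv q r"]
      by (auto simp: f_def insert_commute neq_iff)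
  qed
  ultimately show ?thesis
    unfolding maker_wins_def by blast
qed

end

theorem theorem1p3:
  shows "\<exists>\<sigma>. maker_winning_strategy \<sigma>"
proof
  show "maker_winning_strategy strategy"
    unfolding maker_winning_strategy_def
  proof (intro allI impI)
    fix p assume p: "follows strategy p \<and> (\<forall>k. legal_move p (2 * k + 1))"
    then interpret play p
      by unfold_locales (auto simp: follows_def strategy_run legal_move_def)
    show "(\<forall>k. legal_move p (2 * k)) \<and> maker_wins p"
      using maker_legal maker_wins by blast
  qed
qed

end
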